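(* Let $n \ge 1$ be an integer, let $\epsilon \in (0,1)$, and let $\mathcal{X}, \mathcal{Y} \subseteq \{0,1\}^n$ be nonempty. Let $X$ be uniformly distributed on $\{0,1\}^n$, and let $Y$ be a random variable with values in $\{0,1\}^n$ such that, given $X$, for each $1 \le i \le n$ independently, $\Pr[X_i = Y_i] = \frac{1+\epsilon}{2}$. Then $$E[\mathbf{1}_{\mathcal{X}}(X)\,\mathbf{1}_{\mathcal{Y}}(Y)] \le \left(\mu(\mathcal{X})\,\mu(\mathcal{Y})\right)^{\frac{1}{1+\epsilon}}.$$
   Context: $\mu$ denotes the uniform probability measure on $\{0,1\}^n$, i.e. $\mu(\mathcal{A}) = |\mathcal{A}|/2^n$ for $\mathcal{A} \subseteq \{0,1\}^n$, and $\mathbf{1}_{\mathcal{A}}$ is the indicator function of $\mathcal{A}$. The condition on $(X,Y)$ means that, conditionally on any fixed value of $X$, the coordinates $Y_1,\dots,Y_n$ are independent, with $Y_i = X_i$ with probability $\frac{1+\epsilon}{2}$ and $Y_i = 1 - X_i$ with probability $\frac{1-\epsilon}{2}$. Equivalently, for all $x,y \in \{0,1\}^n$, $\Pr[X=x, Y=y] = 2^{-n}\left(\frac{1+\epsilon}{2}\right)^{a(x,y)}\left(\frac{1-\epsilon}{2}\right)^{d(x,y)}$, where $a(x,y)$ and $d(x,y)$ are the numbers of coordinates on which $x$ and $y$ agree and differ, respectively. *)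

theory Defs
  imports "HOL-Probability.Probability"
begin

definition cube :: "nat \<Rightarrow> (nat \<Rightarrow> nat) set" where
  "cube n = {1..n} \<rightarrow>\<^sub>E {0, 1}"

definition mu :: "nat \<Rightarrow> (nat \<Rightarrow> nat) measure" where
  "mu n = uniform_count_measure (cube n)"

definition conditioned_on :: "'w measure \<Rightarrow> ('w \<Rightarrow> 'b) \<Rightarrow> 'b \<Rightarrow> 'w measure" where
  "conditioned_on M X x = uniform_measure M {w \<in> space M. X w = x}"

text \<open>
  Given \<open>X = x\<close>, the coordinates of \<open>Y\<close> are independent, and each agrees with the
  corresponding coordinate of \<open>x\<close> with probability \<open>(1 + \<epsilon>) / 2\<close>. Every value \<open>x\<close> in the cube
  has probability \<open>2\<^sup>-\<^sup>n\<close> when \<open>X\<close> is uniform, so the conditioning is on events of positive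
  probability.
\<close>

definition noisy_copy ::
  "nat \<Rightarrow> real \<Rightarrow> 'w measure \<Rightarrow> ('w \<Rightarrow> nat \<Rightarrow> nat) \<Rightarrow> ('w \<Rightarrow> nat \<Rightarrow> nat) \<Rightarrow> bool" where
  "noisy_copy n \<epsilon> M X Y \<longleftrightarrow>
     (\<forall>x\<in>cube n.
        prob_space.indep_vars (conditioned_on M X x)
          (\<lambda>_. count_space {0, 1}) (\<lambda>i w. Y w i) {1..n} \<and>
        (\<forall>i\<in>{1..n}. measure (conditioned_on M X x) {w \<in> space M. Y w i = x i} = (1 + \<epsilon>) / 2))"

end

theory Submission
  imports Defs
begin

text \<open>
  The bound is the two-function form of hypercontractivity of the noise operator,
  \<open>E[f(X) g(Y)] \<le> \<parallel>f\<parallel>\<^sub>p \<parallel>g\<parallel>\<^sub>p\<close> with \<open>p = 1 + \<epsilon>\<close>, applied to indicator functions,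
  for which \<open>\<parallel>1\<^sub>A\<parallel>\<^sub>p = \<mu>(A) powr (1/p)\<close>.

  The inequality for arbitrary nonnegative functions tensorizes: conditioning on one coordinate
  of \<open>X\<close> and of \<open>Y\<close> leaves four pairs of functions on a smaller cube, the induction hypothesis
  bounds each of the four expectations by a product of norms, and the one-coordinate inequality,
  applied to these norms as if they were the two values of a function on one bit, reassembles the
  norms on the full cube (\<open>two_function_hypercontractive\<close>). Indicators alone would not suffice
  for the one-bit step, since the norms of the restrictions take arbitrary values.

  On a single bit, write the two functions as \<open>u \<plusminus> v\<close> and \<open>u' \<plusminus> v'\<close>. The left-hand side is
  \<open>u u' + \<epsilon> v v'\<close>, and Cauchy-Schwarz splits it into the factors \<open>sqrt (u\<^sup>2 + \<epsilon> v\<^sup>2)\<close> and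
  \<open>sqrt (u'\<^sup>2 + \<epsilon> v'\<^sup>2)\<close>, so that only Bonami's inequality for one function remains
  (\<open>two_point_bonami\<close>). After scaling to \<open>u = 1\<close> and \<open>v = t\<close> it follows from
  \<open>(1 + (p - 1) t\<^sup>2) powr (p/2) \<le> 1 + p (p - 1) t\<^sup>2 / 2 \<le> ((1 + t) powr p + (1 - t) powr p) / 2\<close>:
  Bernoulli's inequality gives the first step, and the middle term is the second-order Taylor
  polynomial of the right-hand side.

  The probabilistic hypotheses enter only through the joint law of \<open>(X, Y)\<close>
  (\<open>joint_law_noisy_copy\<close>), which turns the expectation into a weighted sum over pairs of points.
\<close>

section \<open>The two-point inequality\<close>

text \<open>
  By the AM-GM inequality the sum is at least \<open>2 ((1 + t) (1 - t)) powr (q/2)\<close>, and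
  \<open>1 - t\<^sup>2 \<le> 1\<close> is raised to a nonpositive exponent.
\<close>

lemma nonpos_powr_sum_ge_two:
  fixes t q :: real
  assumes "\<bar>t\<bar> < 1" and "q \<le> 0"
  shows "2 \<le> (1 + t) powr q + (1 - t) powr q"
proof -
  define a where "a = (1 + t) powr (q / 2)"
  define b where "b = (1 - t) powr (q / 2)"
  have sq: "(1 + t) powr q = a\<^sup>2" "(1 - t) powr q = b\<^sup>2"
    by (simp_all add: a_def b_def power2_eq_square flip: powr_add)
  have "a * b = ((1 + t) * (1 - t)) powr (q / 2)"
    using assms by (simp add: a_def b_def powr_mult)
  also have "\<dots> \<ge> 1 powr (q / 2)"
  proof (intro powr_mono2')
    show "0 < (1 + t) * (1 - t)"
      using assms by (intro mult_pos_pos) auto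
    show "(1 + t) * (1 - t) \<le> 1"
      by (simp add: algebra_simps)
  qed (use assms in auto)
  finally have "1 \<le> a * b" by simp
  moreover have "0 \<le> (a - b)\<^sup>2" by simp
  ultimately show ?thesis
    by (simp add: sq power2_diff)
qed

text \<open>
  Twice the difference of the two sides vanishes to first order at \<open>0\<close>, and its second derivative
  is \<open>p (p - 1) ((1 + t) powr (p - 2) + (1 - t) powr (p - 2) - 2)\<close>, which is nonnegative by the
  previous lemma because \<open>p \<le> 2\<close>. At \<open>t = 1\<close> the derivatives may fail to exist, so monotonicity
  is derived from the open interval together with continuity on the closed one.
\<close>

lemma powr_mean_ge_quadratic:
  fixes p t :: real
  assumes p: "1 < p" "p \<le> 2" and t: "0 \<le> t" "t \<le> 1"
  shows "1 + p * (p - 1) / 2 * t\<^sup>2 \<le> ((1 + t) powr p + (1 - t) powr p) / 2"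
proof -
  define h where "h s = (1 + s) powr p + (1 - s) powr p - p * (p - 1) * s\<^sup>2" for s :: real
  define h1 where "h1 s = p * ((1 + s) powr (p - 1) - (1 - s) powr (p - 1)) - 2 * p * (p - 1) * s" for s :: real
  have h1_nonneg: "0 \<le> h1 s" if s: "0 < s" "s < 1" for s
  proof -
    have "h1 0 \<le> h1 s"
    proof (rule DERIV_nonneg_imp_increasing_open[where f = h1])
      show "\<exists>y. DERIV h1 x :> y \<and> 0 \<le> y" if x: "0 < x" "x < s" for x
      proof (intro exI conjI)
        show "DERIV h1 x :> p * (p - 1) * ((1 + x) powr (p - 2) + (1 - x) powr (p - 2) - 2)"
          unfolding h1_def using x s
          by (auto intro!: derivative_eq_intros simp: algebra_simps)
        have "2 \<le> (1 + x) powr (p - 2) + (1 - x) powr (p - 2)"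
          using x s p by (intro nonpos_powr_sum_ge_two) auto
        then show "0 \<le> p * (p - 1) * ((1 + x) powr (p - 2) + (1 - x) powr (p - 2) - 2)"
          using p by (intro mult_nonneg_nonneg) auto
      qed
      show "continuous_on {0..s} h1"
        unfolding h1_def using s p by (auto intro!: continuous_intros)
    qed (use s in auto)
    then show ?thesis by (simp add: h1_def)
  qed
  have "h 0 \<le> h t"
  proof (rule DERIV_nonneg_imp_increasing_open[where f = h])
    show "\<exists>y. DERIV h x :> y \<and> 0 \<le> y" if x: "0 < x" "x < t" for x
    proof (intro exI conjI)
      show "DERIV h x :> h1 x"
        unfolding h_def h1_def using x t
        by (auto intro!: derivative_eq_intros simp: algebra_simps)
      show "0 \<le> h1 x" using h1_nonneg x t by simp
    qed
    show "continuous_on {0..t} h"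
      unfolding h_def using t p by (intro continuous_on_add continuous_on_diff continuous_on_mult
          continuous_on_powr' continuous_on_power continuous_on_const continuous_on_id) auto
  qed (use t in auto)
  then show ?thesis by (simp add: h_def field_simps)
qed

text \<open>
  Bernoulli's inequality for exponents in \<open>[0, 1]\<close>, as weighted AM-GM for \<open>1 + x\<close> and \<open>1\<close>.
\<close>

lemma bernoulli_powr_le:
  fixes r x :: real
  assumes "0 \<le> r" "r \<le> 1" "0 \<le> x"
  shows "(1 + x) powr r \<le> 1 + r * x"
proof -
  have "(1 + x) powr r * 1 powr (1 - r) \<le> r * (1 + x) + (1 - r) * 1"
    using assms by (intro Youngs_inequality_0) auto
  then show ?thesis by (simp add: algebra_simps)
qed

text \<open>
  Both sides are symmetric in \<open>a\<close> and \<open>b\<close> and homogeneous of degree one, so the pair may be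
  scaled to \<open>(1 + t, 1 - t)\<close> with \<open>0 \<le> t \<le> 1\<close>. The exponent \<open>p/2\<close> to which Bernoulli's inequality
  is applied is at most \<open>1\<close>, and the linear term that it yields is exactly the quadratic
  coefficient in \<open>powr_mean_ge_quadratic\<close>.
\<close>

lemma two_point_bonami:
  fixes p a b :: real
  assumes p: "1 < p" "p \<le> 2" and "0 \<le> a" "0 \<le> b"
  shows "sqrt (((a + b) / 2)\<^sup>2 + (p - 1) * ((a - b) / 2)\<^sup>2)
           \<le> ((a powr p + b powr p) / 2) powr (1 / p)"
  using \<open>0 \<le> a\<close> \<open>0 \<le> b\<close>
proof (induction b a rule: linorder_wlog)
  case (le b a)
  show ?case
  proof (cases "a = 0")
    case True
    then show ?thesis using le by simp
  next
    case False
    define u where "u = (a + b) / 2"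
    define t where "t = (a - b) / (a + b)"
    have u: "0 < u" and t: "0 \<le> t" "t \<le> 1"
      using le False by (auto simp: u_def t_def field_simps)
    have a: "a = u * (1 + t)" and b: "b = u * (1 - t)"
      using le False by (auto simp: u_def t_def field_simps)
    have "(1 + (p - 1) * t\<^sup>2) powr (p / 2) \<le> 1 + p / 2 * ((p - 1) * t\<^sup>2)"
      using p by (intro bernoulli_powr_le) auto
    also have "\<dots> \<le> ((1 + t) powr p + (1 - t) powr p) / 2"
      using powr_mean_ge_quadratic[OF p t] by simp
    finally have "((1 + (p - 1) * t\<^sup>2) powr (p / 2)) powr (1 / p)
        \<le> (((1 + t) powr p + (1 - t) powr p) / 2) powr (1 / p)"
      using p by (intro powr_mono2) auto
    then have *: "sqrt (1 + (p - 1) * t\<^sup>2) \<le> (((1 + t) powr p + (1 - t) powr p) / 2) powr (1 / p)"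
      using p by (simp add: powr_powr powr_half_sqrt)
    have "sqrt (((a + b) / 2)\<^sup>2 + (p - 1) * ((a - b) / 2)\<^sup>2) = sqrt (u\<^sup>2 * (1 + (p - 1) * t\<^sup>2))"
      unfolding a b by (simp add: algebra_simps power2_eq_square)
    also have "\<dots> = u * sqrt (1 + (p - 1) * t\<^sup>2)"
      using u by (simp add: real_sqrt_mult)
    also have "\<dots> \<le> u * (((1 + t) powr p + (1 - t) powr p) / 2) powr (1 / p)"
      using u * by simp
    also have "\<dots> = (u powr p * (((1 + t) powr p + (1 - t) powr p) / 2)) powr (1 / p)"
      using u p by (subst powr_mult) (auto simp: powr_powr)
    also have "u powr p * (((1 + t) powr p + (1 - t) powr p) / 2) = (a powr p + b powr p) / 2"
      unfolding a b using u t by (subst (1 2) powr_mult) (auto simp: distrib_left)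
    finally show ?thesis .
  qed
next
  case (sym b a)
  then show ?case
    by (simp add: add.commute power2_commute[of a b] power_divide)
qed

text \<open>
  In the coordinates given by mean and half-difference, the correlated expectation is the
  bilinear form \<open>u u' + \<epsilon> v v'\<close>. Cauchy-Schwarz for this form separates the two functions, and
  \<open>\<epsilon> = p - 1\<close> is the constant that \<open>two_point_bonami\<close> admits for each factor.
\<close>

lemma two_point_hypercontractive:
  fixes \<epsilon> a b c d :: real
  assumes e: "0 < \<epsilon>" "\<epsilon> \<le> 1" and nn: "0 \<le> a" "0 \<le> b" "0 \<le> c" "0 \<le> d"
  shows "(1 + \<epsilon>) / 4 * (a * c + b * d) + (1 - \<epsilon>) / 4 * (a * d + b * c)
           \<le> ((a powr (1 + \<epsilon>) + b powr (1 + \<epsilon>)) / 2) powr (1 / (1 + \<epsilon>))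
              * ((c powr (1 + \<epsilon>) + d powr (1 + \<epsilon>)) / 2) powr (1 / (1 + \<epsilon>))"
proof -
  define u v u' v' where "u = (a + b) / 2" and "v = (a - b) / 2"
    and "u' = (c + d) / 2" and "v' = (c - d) / 2"
  have "(u * u' + \<epsilon> * v * v')\<^sup>2 \<le> (u\<^sup>2 + \<epsilon> * v\<^sup>2) * (u'\<^sup>2 + \<epsilon> * v'\<^sup>2)"
  proof -
    have "(u\<^sup>2 + \<epsilon> * v\<^sup>2) * (u'\<^sup>2 + \<epsilon> * v'\<^sup>2) - (u * u' + \<epsilon> * v * v')\<^sup>2 = \<epsilon> * (u * v' - v * u')\<^sup>2"
      by (simp add: power2_eq_square algebra_simps)
    moreover have "0 \<le> \<epsilon> * (u * v' - v * u')\<^sup>2" using e by simp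
    ultimately show ?thesis by linarith
  qed
  then have "u * u' + \<epsilon> * v * v' \<le> sqrt (u\<^sup>2 + \<epsilon> * v\<^sup>2) * sqrt (u'\<^sup>2 + \<epsilon> * v'\<^sup>2)"
    by (metis real_le_rsqrt real_sqrt_mult)
  also have "\<dots> \<le> ((a powr (1 + \<epsilon>) + b powr (1 + \<epsilon>)) / 2) powr (1 / (1 + \<epsilon>))
              * ((c powr (1 + \<epsilon>) + d powr (1 + \<epsilon>)) / 2) powr (1 / (1 + \<epsilon>))"
    using two_point_bonami[of "1 + \<epsilon>" a b] two_point_bonami[of "1 + \<epsilon>" c d] e nn
    by (intro mult_mono) (auto simp: u_def v_def u'_def v'_def)
  also have "u * u' + \<epsilon> * v * v'
      = (1 + \<epsilon>) / 4 * (a * c + b * d) + (1 - \<epsilon>) / 4 * (a * d + b * c)"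
    by (simp add: u_def v_def u'_def v'_def field_simps)
  finally show ?thesis .
qed

section \<open>Tensorization over the coordinates\<close>

abbreviation bits :: "'i set \<Rightarrow> ('i \<Rightarrow> nat) set" where
  "bits I \<equiv> I \<rightarrow>\<^sub>E {0, 1}"

text \<open>
  This is the joint probability that a uniform point is \<open>x\<close> and its noisy copy is \<open>y\<close>: each
  factor \<open>(1 \<plusminus> \<epsilon>) / 4\<close> combines the probability \<open>1/2\<close> of the bit of \<open>x\<close> with the conditional
  probability \<open>(1 \<plusminus> \<epsilon>) / 2\<close> of the bit of \<open>y\<close>.
\<close>

definition noise_weight :: "real \<Rightarrow> 'i set \<Rightarrow> ('i \<Rightarrow> nat) \<Rightarrow> ('i \<Rightarrow> nat) \<Rightarrow> real" where
  "noise_weight \<epsilon> I x y = (\<Prod>i\<in>I. if x i = y i then (1 + \<epsilon>) / 4 else (1 - \<epsilon>) / 4)"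

text \<open>The \<open>L\<^sup>p\<close> norm of a nonnegative function with respect to the uniform probability.\<close>

definition bits_norm :: "real \<Rightarrow> 'i set \<Rightarrow> (('i \<Rightarrow> nat) \<Rightarrow> real) \<Rightarrow> real" where
  "bits_norm p I f = ((\<Sum>x\<in>bits I. f x powr p) / 2 ^ card I) powr (1 / p)"

lemma sum_bits_insert:
  fixes F :: "('i \<Rightarrow> nat) \<Rightarrow> real"
  assumes "i \<notin> I"
  shows "(\<Sum>x\<in>bits (insert i I). F x)
           = (\<Sum>x\<in>bits I. F (x(i := 0))) + (\<Sum>x\<in>bits I. F (x(i := 1)))"
proof -
  have "(\<Sum>x\<in>bits (insert i I). F x) = (\<Sum>z\<in>{0, 1} \<times> bits I. F ((snd z)(i := fst z)))"
    unfolding PiE_insert_eq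
    using sum.reindex[OF inj_combinator[OF assms, of "\<lambda>_. {0, 1::nat}"], of F]
    by (simp add: case_prod_unfold o_def)
  also have "\<dots> = (\<Sum>a\<in>{0, 1}. \<Sum>x\<in>bits I. F (x(i := a)))"
    by (simp add: sum.cartesian_product case_prod_unfold)
  finally show ?thesis by simp
qed

lemma noise_weight_insert:
  assumes "finite I" "i \<notin> I"
  shows "noise_weight \<epsilon> (insert i I) (x(i := a)) (y(i := b))
           = (if a = b then (1 + \<epsilon>) / 4 else (1 - \<epsilon>) / 4) * noise_weight \<epsilon> I x y"
proof -
  have "(\<Prod>j\<in>I. if (x(i := a)) j = (y(i := b)) j then (1 + \<epsilon>) / 4 else (1 - \<epsilon>) / 4)
      = (\<Prod>j\<in>I. if x j = y j then (1 + \<epsilon>) / 4 else (1 - \<epsilon>) / 4)"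
    using assms by (intro prod.cong) auto
  then show ?thesis
    using assms by (simp add: noise_weight_def)
qed

text \<open>
  The norm of a function is the one-bit norm of the pair of norms of its two restrictions. This is
  why the one-bit inequality tensorizes.
\<close>

lemma bits_norm_insert:
  assumes "finite I" "i \<notin> I" "0 < p"
  shows "bits_norm p (insert i I) f
           = ((bits_norm p I (\<lambda>x. f (x(i := 0))) powr p
               + bits_norm p I (\<lambda>x. f (x(i := 1))) powr p) / 2) powr (1 / p)"
proof -
  have *: "bits_norm p I g powr p = (\<Sum>x\<in>bits I. g x powr p) / 2 ^ card I" for g
    using assms by (simp add: bits_norm_def powr_powr sum_nonneg)
  show ?thesis
    unfolding * unfolding bits_norm_def sum_bits_insert[OF assms(2)]
    using assms by (simp add: field_simps)
qed

text \<open>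
  Induction on the coordinates: the induction hypothesis is applied to the four pairs of
  restrictions, and the one-bit inequality to the norms \<open>F a\<close>, \<open>G b\<close> of these restrictions.
  Nonnegativity of \<open>1 - \<epsilon>\<close> allows the four bounds to be added with their weights.
\<close>

theorem two_function_hypercontractive:
  fixes f g :: "('i \<Rightarrow> nat) \<Rightarrow> real"
  assumes "finite I" and e: "0 < \<epsilon>" "\<epsilon> \<le> 1"
    and "\<And>x. 0 \<le> f x" "\<And>x. 0 \<le> g x"
  shows "(\<Sum>x\<in>bits I. \<Sum>y\<in>bits I. noise_weight \<epsilon> I x y * (f x * g y))
           \<le> bits_norm (1 + \<epsilon>) I f * bits_norm (1 + \<epsilon>) I g"
  using assms(1,4,5)
proof (induction I arbitrary: f g rule: finite_induct)
  case empty
  then show ?case using e by (simp add: noise_weight_def bits_norm_def powr_powr)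
next
  case (insert i I)
  define S where "S a b = (\<Sum>x\<in>bits I. \<Sum>y\<in>bits I.
      noise_weight \<epsilon> I x y * (f (x(i := a)) * g (y(i := b))))" for a b
  define k where "k a b = (if a = b then (1 + \<epsilon>) / 4 else (1 - \<epsilon>) / 4)" for a b :: nat
  define F where "F a = bits_norm (1 + \<epsilon>) I (\<lambda>x. f (x(i := a)))" for a
  define G where "G a = bits_norm (1 + \<epsilon>) I (\<lambda>x. g (x(i := a)))" for a
  have S: "S a b \<le> F a * G b" for a b
    unfolding S_def F_def G_def by (intro insert.IH insert.prems)
  have nn: "0 \<le> F a" "0 \<le> G a" for a
    by (simp_all add: F_def G_def bits_norm_def)
  have "(\<Sum>x\<in>bits (insert i I). \<Sum>y\<in>bits (insert i I). noise_weight \<epsilon> (insert i I) x y * (f x * g y))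
      = k 0 0 * S 0 0 + k 0 1 * S 0 1 + (k 1 0 * S 1 0 + k 1 1 * S 1 1)"
    unfolding sum_bits_insert[OF insert.hyps(2)] noise_weight_insert[OF insert.hyps] S_def
      k_def[symmetric]
    by (simp only: sum.distrib sum_distrib_left mult.assoc)
  also have "\<dots> = (1 + \<epsilon>) / 4 * (S 0 0 + S 1 1) + (1 - \<epsilon>) / 4 * (S 0 1 + S 1 0)"
    by (simp add: k_def distrib_left)
  also have "\<dots> \<le> (1 + \<epsilon>) / 4 * (F 0 * G 0 + F 1 * G 1) + (1 - \<epsilon>) / 4 * (F 0 * G 1 + F 1 * G 0)"
    using e by (intro add_mono mult_left_mono S) auto
  also have "\<dots> \<le> ((F 0 powr (1 + \<epsilon>) + F 1 powr (1 + \<epsilon>)) / 2) powr (1 / (1 + \<epsilon>))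
                 * ((G 0 powr (1 + \<epsilon>) + G 1 powr (1 + \<epsilon>)) / 2) powr (1 / (1 + \<epsilon>))"
    by (intro two_point_hypercontractive e nn)
  also have "\<dots> = bits_norm (1 + \<epsilon>) (insert i I) f * bits_norm (1 + \<epsilon>) (insert i I) g"
    using e insert.hyps by (simp add: bits_norm_insert F_def G_def)
  finally show ?case .
qed

section \<open>The joint law of a point and its noisy copy\<close>

lemma finite_cube [simp]: "finite (cube n)"
  by (simp add: cube_def finite_PiE)

lemma card_cube: "card (cube n) = 2 ^ n"
  by (simp add: cube_def card_PiE numeral_2_eq_2)

lemma measure_mu: "A \<subseteq> cube n \<Longrightarrow> measure (mu n) A = real (card A) / 2 ^ n"
  by (simp add: mu_def measure_uniform_count_measure card_cube)

text \<open>
  The event \<open>X = x\<close> has positive probability \<open>1 / 2 ^ n\<close>, so conditioning on it yields a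
  probability space in which the law of \<open>Y\<close> is a product. The hypothesis gives only the probability
  of agreement with \<open>x\<close>; since there are just two bit values, the probability of the other value
  is the complement.
\<close>

lemma (in prob_space) joint_law_noisy_copy:
  assumes n: "n \<ge> 1"
    and X: "X \<in> measurable M (count_space (cube n))"
    and Y: "Y \<in> measurable M (count_space (cube n))"
    and law: "distr M (count_space (cube n)) X = mu n"
    and noisy: "noisy_copy n \<epsilon> M X Y"
    and x: "x \<in> cube n" and y: "y \<in> cube n"
  shows "prob {w \<in> space M. X w = x \<and> Y w = y} = noise_weight \<epsilon> {1..n} x y"
proof -
  define E where "E = {w \<in> space M. X w = x}"
  define N where "N = conditioned_on M X x"
  have N: "N = uniform_measure M E"
    by (simp add: N_def E_def conditioned_on_def)
  have E_eq: "E = X -` {x} \<inter> space M" by (auto simp: E_def)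
  have E_sets: "E \<in> events"
    unfolding E_eq using X x by (intro measurable_sets) auto
  have "prob E = measure (distr M (count_space (cube n)) X) {x}"
    unfolding E_eq using X x by (subst measure_distr) auto
  also have "\<dots> = 1 / 2 ^ n"
    using x by (simp add: law measure_mu)
  finally have pE: "prob E = 1 / 2 ^ n" .
  then have E0: "emeasure M E \<noteq> 0"
    by (simp add: emeasure_eq_measure)
  interpret N: prob_space N
    unfolding N by (intro prob_space_uniform_measure E0) simp
  have Y_cube: "Y w \<in> cube n" if "w \<in> space M" for w
    using measurable_space[OF Y that] by simp
  have Y_pred: "{w \<in> space M. P (Y w)} \<in> events" for P
  proof -
    have "{w \<in> space M. P (Y w)} = Y -` {z \<in> cube n. P z} \<inter> space M"
      using Y_cube by auto
    also have "\<dots> \<in> events"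
      using Y by (intro measurable_sets) auto
    finally show ?thesis .
  qed
  have N_space: "space N = space M" and N_sets: "sets N = sets M"
    by (simp_all add: N)
  have agree: "N.prob {w \<in> space M. Y w i = x i} = (1 + \<epsilon>) / 2" if "i \<in> {1..n}" for i
    using noisy x that unfolding noisy_copy_def N_def by blast
  have coord: "N.prob {w \<in> space M. Y w i = y i} = (if x i = y i then (1 + \<epsilon>) / 2 else (1 - \<epsilon>) / 2)"
    if i: "i \<in> {1..n}" for i
  proof (cases "x i = y i")
    case True
    then show ?thesis using agree[OF i] by simp
  next
    case False
    have "{w \<in> space M. Y w i = y i} = space N - {w \<in> space M. Y w i = x i}"
    proof -
      have "Y w i = y i \<longleftrightarrow> Y w i \<noteq> x i" if "w \<in> space M" for w
      proof -
        have "Y w i \<in> {0, 1}" "x i \<in> {0, 1}" "y i \<in> {0, 1}"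
          using Y_cube[OF that] x y i unfolding cube_def by (blast dest: PiE_mem)+
        with False show ?thesis by auto
      qed
      then show ?thesis by (auto simp: N_space)
    qed
    also have "N.prob \<dots> = 1 - (1 + \<epsilon>) / 2"
      using agree[OF i] Y_pred[of "\<lambda>z. z i = x i"]
      by (subst N.prob_compl) (auto simp: N_sets)
    finally show ?thesis using False by (simp add: field_simps)
  qed
  have "N.indep_vars (\<lambda>_. count_space {0, 1}) (\<lambda>i w. Y w i) {1..n}"
    using noisy x unfolding noisy_copy_def N_def by blast
  then have "N.prob (\<Inter>i\<in>{1..n}. (\<lambda>w. Y w i) -` {y i} \<inter> space N)
      = (\<Prod>i\<in>{1..n}. N.prob ((\<lambda>w. Y w i) -` {y i} \<inter> space N))"
    using n y by (intro N.indep_varsD) (auto simp: cube_def dest: PiE_mem)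
  also have "(\<Inter>i\<in>{1..n}. (\<lambda>w. Y w i) -` {y i} \<inter> space N) = {w \<in> space M. Y w = y}"
  proof -
    have "Y w = y" if "w \<in> space M" "\<forall>i\<in>{1..n}. Y w i = y i" for w
      using Y_cube[OF that(1)] y that(2) unfolding cube_def by (intro PiE_ext) auto
    then show ?thesis using n by (auto simp: N_space)
  qed
  also have "(\<Prod>i\<in>{1..n}. N.prob ((\<lambda>w. Y w i) -` {y i} \<inter> space N))
      = (\<Prod>i\<in>{1..n}. if x i = y i then (1 + \<epsilon>) / 2 else (1 - \<epsilon>) / 2)"
  proof (intro prod.cong refl)
    fix i assume i: "i \<in> {1..n}"
    have "(\<lambda>w. Y w i) -` {y i} \<inter> space N = {w \<in> space M. Y w i = y i}"
      by (auto simp: N_space)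
    then show "N.prob ((\<lambda>w. Y w i) -` {y i} \<inter> space N)
        = (if x i = y i then (1 + \<epsilon>) / 2 else (1 - \<epsilon>) / 2)"
      using coord[OF i] by simp
  qed
  finally have cond: "N.prob {w \<in> space M. Y w = y}
      = (\<Prod>i\<in>{1..n}. if x i = y i then (1 + \<epsilon>) / 2 else (1 - \<epsilon>) / 2)" .
  have "{w \<in> space M. X w = x \<and> Y w = y} = E \<inter> {w \<in> space M. Y w = y}"
    by (auto simp: E_def)
  then have "prob {w \<in> space M. X w = x \<and> Y w = y} = prob E * N.prob {w \<in> space M. Y w = y}"
    using E0 E_sets Y_pred[of "\<lambda>z. z = y"] pE
    by (simp add: N measure_uniform_measure)
  also have "\<dots> = (\<Prod>i\<in>{1..n}. 1 / 2 * (if x i = y i then (1 + \<epsilon>) / 2 else (1 - \<epsilon>) / 2))"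
    unfolding pE cond prod.distrib by (simp add: power_one_over)
  also have "\<dots> = noise_weight \<epsilon> {1..n} x y"
    unfolding noise_weight_def by (intro prod.cong) auto
  finally show ?thesis .
qed

lemma bits_norm_indicator:
  assumes "A \<subseteq> cube n" "0 < p"
  shows "bits_norm p {1..n} (indicator A) = measure (mu n) A powr (1 / p)"
proof -
  have "(\<Sum>x\<in>cube n. indicator A x powr p) = (\<Sum>x\<in>cube n. indicator A x :: real)"
    using assms by (intro sum.cong) (auto simp: indicator_def)
  also have "\<dots> = real (card A)"
    using assms(1) by (simp add: indicator_def Int_absorb1)
  finally show ?thesis
    using assms unfolding bits_norm_def cube_def[symmetric] by (simp add: measure_mu)
qed

theorem theorem2p1:
  fixes n :: nat and \<epsilon> :: real
    and A B :: "(nat \<Rightarrow> nat) set"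
    and M :: "'w measure" and X Y :: "'w \<Rightarrow> nat \<Rightarrow> nat"
  assumes "n \<ge> 1" and "0 < \<epsilon>" and "\<epsilon> < 1"
    and "A \<subseteq> cube n" and "A \<noteq> {}"
    and "B \<subseteq> cube n" and "B \<noteq> {}"
    and "prob_space M"
    and "X \<in> measurable M (count_space (cube n))"
    and "Y \<in> measurable M (count_space (cube n))"
    and "distr M (count_space (cube n)) X = mu n"
    and "noisy_copy n \<epsilon> M X Y"
  shows "(\<integral>w. indicator A (X w) * indicator B (Y w) \<partial>M)
           \<le> (measure (mu n) A * measure (mu n) B) powr (1 / (1 + \<epsilon>))"
proof -
  interpret prob_space M by fact
  define E where "E x y = {w \<in> space M. X w = x \<and> Y w = y}" for x y
  have E: "E x y \<in> events" if "x \<in> cube n" "y \<in> cube n" for x y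
  proof -
    have "E x y = (X -` {x} \<inter> space M) \<inter> (Y -` {y} \<inter> space M)"
      by (auto simp: E_def)
    also have "\<dots> \<in> events"
      using that assms(9,10) by (intro sets.Int measurable_sets) auto
    finally show ?thesis .
  qed
  \<comment> \<open>Expanding over all pairs of points makes the integrand a finite combination of
    indicators of events whose probabilities are known.\<close>
  have "indicator A (X w) * indicator B (Y w)
      = (\<Sum>x\<in>cube n. \<Sum>y\<in>cube n. indicator (E x y) w * (indicator A x * indicator B y :: real))"
    if w: "w \<in> space M" for w
  proof -
    have XY: "X w \<in> cube n" "Y w \<in> cube n"
      using measurable_space[OF assms(9) w] measurable_space[OF assms(10) w] by simp_all
    have "(\<Sum>x\<in>cube n. \<Sum>y\<in>cube n. indicator (E x y) w * (indicator A x * indicator B y :: real))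
        = (\<Sum>x\<in>cube n. if x = X w then \<Sum>y\<in>cube n. if y = Y w then indicator A x * indicator B y else 0 else 0)"
      using w by (intro sum.cong refl) (auto simp: E_def indicator_def intro!: sum.cong sum.neutral)
    then show ?thesis using XY by simp
  qed
  then have "(\<integral>w. indicator A (X w) * indicator B (Y w) \<partial>M)
      = (\<integral>w. (\<Sum>x\<in>cube n. \<Sum>y\<in>cube n. indicator (E x y) w * (indicator A x * indicator B y :: real)) \<partial>M)"
    by (intro Bochner_Integration.integral_cong refl)
  also have "\<dots> = (\<Sum>x\<in>cube n. \<Sum>y\<in>cube n. prob (E x y) * (indicator A x * indicator B y))"
  proof -
    have int: "integrable M (\<lambda>w. indicator (E x y) w * (indicator A x * indicator B y :: real))"
      if "x \<in> cube n" "y \<in> cube n" for x y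
      using E[OF that] by (intro integrable_mult_left integrable_real_indicator) (auto simp: emeasure_eq_measure)
    have "(\<integral>w. indicator (E x y) w * (indicator A x * indicator B y :: real) \<partial>M)
        = prob (E x y) * (indicator A x * indicator B y)" for x y
      by (simp only: integral_mult_left_zero integral_indicator) (simp add: E_def Int_absorb2 Collect_conj_eq)
    moreover have "expectation (\<lambda>w. \<Sum>x\<in>cube n. \<Sum>y\<in>cube n. indicator (E x y) w * (indicator A x * indicator B y :: real))
        = (\<Sum>x\<in>cube n. \<Sum>y\<in>cube n. expectation (\<lambda>w. indicator (E x y) w * (indicator A x * indicator B y)))"
      by (subst Bochner_Integration.integral_sum, intro Bochner_Integration.integrable_sum int, assumption+,
          intro sum.cong refl, subst Bochner_Integration.integral_sum, intro int, assumption+, rule refl)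
    ultimately show ?thesis by (simp only:)
  qed
  also have "\<dots> = (\<Sum>x\<in>cube n. \<Sum>y\<in>cube n. noise_weight \<epsilon> {1..n} x y * (indicator A x * indicator B y))"
    unfolding E_def
    by (intro sum.cong refl arg_cong2[where f = "(*)"] joint_law_noisy_copy assms(1,9-12))
  also have "\<dots> \<le> bits_norm (1 + \<epsilon>) {1..n} (indicator A) * bits_norm (1 + \<epsilon>) {1..n} (indicator B)"
    unfolding cube_def using assms(2,3) by (intro two_function_hypercontractive) auto
  also have "\<dots> = (measure (mu n) A * measure (mu n) B) powr (1 / (1 + \<epsilon>))"
    using assms(2,4,6) by (simp add: bits_norm_indicator powr_mult del: One_nat_def)
  finally show ?thesis .
qed

end
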